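(* As $n\to\infty$, $\nu(n)=o(p(n))$; that is, $\lim_{n\to\infty}\nu(n)/p(n)=0$.
   Context: $p(n)$ is the number of integer partitions of $n$. A nuclear partition is an integer partition with no part equal to $1$, and $\nu(n)$ is the number of nuclear partitions of $n$. *)

theory Defs
  imports Complex_Main "HOL-Library.Multiset" "HOL-Library.Landau_Symbols"
begin

definition partitions :: "nat \<Rightarrow> nat multiset set" where
  "partitions n = {P. (\<forall>k\<in>#P. 1 \<le> k) \<and> sum_mset P = n}"

definition nuclear_partitions :: "nat \<Rightarrow> nat multiset set" where
  "nuclear_partitions n = {P \<in> partitions n. 1 \<notin># P}"

definition p :: "nat \<Rightarrow> nat" where
  "p n = card (partitions n)"

definition nu :: "nat \<Rightarrow> nat" where
  "nu n = card (nuclear_partitions n)"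

(* The cardinalities above are those of finite sets, and the quotient nu n / p n
   never has denominator 0. *)

lemma size_le_sum_mset:
  fixes P :: "nat multiset"
  assumes "\<forall>k\<in>#P. 1 \<le> k"
  shows "size P \<le> sum_mset P"
  using assms by (induction P) auto

lemma finite_partitions: "finite (partitions n)"
proof (rule finite_subset)
  show "partitions n \<subseteq> mset ` {xs. set xs \<subseteq> {..n} \<and> length xs \<le> n}"
  proof
    fix P assume P: "P \<in> partitions n"
    obtain xs where xs: "P = mset xs" by (metis ex_mset)
    have "length xs \<le> n"
      using P size_le_sum_mset[of P] by (auto simp: partitions_def xs)
    moreover have "set xs \<subseteq> {..n}"
      using P by (auto simp: partitions_def xs sum_mset_sum_list member_le_sum_list)
    ultimately show "P \<in> mset ` {xs. set xs \<subseteq> {..n} \<and> length xs \<le> n}"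
      using xs by blast
  qed
  show "finite (mset ` {xs. set xs \<subseteq> {..n} \<and> length xs \<le> n})"
    by (intro finite_imageI finite_lists_length_le) simp
qed

lemma finite_nuclear_partitions: "finite (nuclear_partitions n)"
  using finite_partitions by (simp add: nuclear_partitions_def)

lemma p_pos: "p n > 0"
proof -
  have "replicate_mset n 1 \<in> partitions n"
    by (auto simp: partitions_def)
  then show ?thesis
    using finite_partitions[of n] by (auto simp: p_def card_gt_0_iff)
qed

end

(* Replacing one part k of a nuclear partition by k ones is injective in the pair (partition, k),
   as k is the number of ones of the result. So p n bounds the sum, over nuclear
   partitions of n, of the number of distinct part sizes, and at most p n / K of them have at least
   K part sizes. Those with at most K part sizes are polynomially many in n, whereas p n grows
   faster than every polynomial. *)
theory Submission
  imports Defs "HOL-Library.FuncSet"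
begin

lemma card_nuclear_many_part_sizes:
  "K * card {P \<in> nuclear_partitions n. K \<le> card (set_mset P)} \<le> p n"
proof -
  define A where "A = {P \<in> nuclear_partitions n. K \<le> card (set_mset P)}"
  define f where "f = (\<lambda>(P, k :: nat). (P - {#k#}) + replicate_mset k (1::nat))"
  have finA: "finite A"
    unfolding A_def using finite_nuclear_partitions by simp
  \<comment> \<open>Nuclearity enters here: \<open>P\<close> has no ones of its own, so every one in
    \<open>f (P, k)\<close> comes from the replaced part.\<close>
  have ones: "count (f (P, k)) 1 = k" if "P \<in> A" for P k
    using that by (auto simp: A_def f_def nuclear_partitions_def not_in_iff)
  have "inj_on f (Sigma A set_mset)"
  proof (rule inj_onI, clarify)
    fix P k Q l
    assume P: "P \<in> A" "k \<in># P" and Q: "Q \<in> A" "l \<in># Q" and eq: "f (P, k) = f (Q, l)"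
    have kl: "k = l"
      using ones[OF P(1), of k] ones[OF Q(1), of l] eq by simp
    then have "P - {#k#} = Q - {#k#}"
      using eq by (simp add: f_def)
    then show "P = Q \<and> k = l"
      using P(2) Q(2) kl by (metis insert_DiffM)
  qed
  moreover have "f ` Sigma A set_mset \<subseteq> partitions n"
  proof clarify
    fix P k assume P: "P \<in> A" "k \<in># P"
    then have "sum_mset P = n" "\<forall>i\<in>#P. 1 \<le> i"
      by (auto simp: A_def nuclear_partitions_def partitions_def)
    moreover obtain Q where "P = add_mset k Q"
      using P(2) by (metis insert_DiffM)
    ultimately show "f (P, k) \<in> partitions n"
      by (auto simp: f_def partitions_def split: if_splits)
  qed
  ultimately have "card (Sigma A set_mset) \<le> p n"
    unfolding p_def by (metis card_image card_mono finite_partitions)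
  \<comment> \<open>Each \<open>P\<close> in \<open>A\<close> is paired with at least
    \<open>K\<close> values of \<open>k\<close>.\<close>
  moreover have "card A * K \<le> card (Sigma A set_mset)"
    using sum_mono[of A "\<lambda>_. K" "\<lambda>P. card (set_mset P)"] finA by (auto simp: A_def)
  ultimately show ?thesis
    by (simp add: A_def mult.commute)
qed

text \<open>Such a multiset is encoded by at most \<open>K\<close> pairs (element, multiplicity),
  each with \<open>(n + 1)\<^sup>2\<close> possible values; the induction peels off one pair at a
  time. Finiteness is carried along because \<open>card\<close> is 0 on infinite sets and monotone
  only into finite ones.\<close>

lemma card_msets_few_elements:
  fixes n K :: nat
  defines "B \<equiv> {P :: nat multiset. set_mset P \<subseteq> {..n} \<and> size P \<le> n \<and> card (set_mset P) \<le> K}"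
  shows "finite B \<and> card B \<le> (n + 1) ^ (2 * K)"
  unfolding B_def
proof (induction K)
  case 0
  have "{P :: nat multiset. set_mset P \<subseteq> {..n} \<and> size P \<le> n \<and> card (set_mset P) \<le> 0} = {{#}}"
    by auto
  then show ?case by simp
next
  case (Suc K)
  define C where "C = (\<lambda>K. {P :: nat multiset. set_mset P \<subseteq> {..n} \<and> size P \<le> n \<and> card (set_mset P) \<le> K})"
  define g where "g = (\<lambda>((k :: nat, c), Q). replicate_mset c k + Q)"
  let ?D = "({..n} \<times> {..n}) \<times> C K"
  have IH: "finite (C K)" "card (C K) \<le> (n + 1) ^ (2 * K)"
    using Suc by (auto simp: C_def)
  have sub: "C (Suc K) \<subseteq> g ` ?D"
  proof
    fix P assume P: "P \<in> C (Suc K)"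
    show "P \<in> g ` ?D"
    proof (cases "P = {#}")
      case True
      \<comment> \<open>The empty multiset has no element to peel off; a pair with multiplicity 0
        covers it.\<close>
      then have "P = g ((0, 0), {#})" "((0, 0), {#}) \<in> ?D"
        by (auto simp: g_def C_def)
      then show ?thesis by blast
    next
      case False
      then obtain k where k: "k \<in># P" by auto
      \<comment> \<open>All copies of \<open>k\<close> go at once, so that the number of distinct
        elements drops by one.\<close>
      define Q where "Q = filter_mset (\<lambda>i. i \<noteq> k) P"
      have "set_mset Q = set_mset P - {k}" by (auto simp: Q_def)
      moreover have "size Q \<le> size P"
        unfolding Q_def by (rule size_filter_mset_lesseq)
      ultimately have "Q \<in> C K" using P k by (auto simp: C_def)
      moreover have "k \<le> n" "count P k \<le> n"
        using P k count_le_size[of P k] by (auto simp: C_def)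
      moreover have "P = g ((k, count P k), Q)"
        by (auto simp: g_def Q_def multiset_eq_iff)
      ultimately show ?thesis by blast
    qed
  qed
  have fin: "finite ?D" using IH by simp
  have "card (C (Suc K)) \<le> card ?D"
    using sub fin by (meson card_image_le card_mono finite_imageI le_trans)
  also have "\<dots> = (n + 1)\<^sup>2 * card (C K)"
    by (simp add: card_cartesian_product power2_eq_square)
  also have "\<dots> \<le> (n + 1)\<^sup>2 * (n + 1) ^ (2 * K)"
    using IH(2) by (rule mult_le_mono2)
  also have "\<dots> = (n + 1) ^ (2 * Suc K)"
    by (metis mult_Suc_right power_add)
  finally have "card (C (Suc K)) \<le> (n + 1) ^ (2 * Suc K)" .
  moreover have "finite (C (Suc K))"
    using finite_subset[OF sub] fin by blast
  ultimately show ?case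
    unfolding C_def by blast
qed

lemma card_partitions_few_part_sizes:
  "card {P \<in> partitions n. card (set_mset P) \<le> K} \<le> (n + 1) ^ (2 * K)"
proof -
  have "{P \<in> partitions n. card (set_mset P) \<le> K}
      \<subseteq> {P. set_mset P \<subseteq> {..n} \<and> size P \<le> n \<and> card (set_mset P) \<le> K}"
  proof (rule Collect_mono, rule impI)
    fix P assume *: "P \<in> partitions n \<and> card (set_mset P) \<le> K"
    then have P: "\<forall>k\<in>#P. 1 \<le> k" "sum_mset P = n"
      by (auto simp: partitions_def)
    have "k \<le> n" if "k \<in># P" for k
      using that P(2) by (metis insert_DiffM le_add1 sum_mset.add_mset)
    then show "set_mset P \<subseteq> {..n} \<and> size P \<le> n \<and> card (set_mset P) \<le> K"
      using * size_le_sum_mset[OF P(1)] P(2) by auto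
  qed
  then show ?thesis
    using card_msets_few_elements[of n K] by (meson card_mono le_trans)
qed

text \<open>The multiplicities of the parts \<open>2, \<dots>, M + 1\<close> can be chosen freely up to
  \<open>n div (M + 1)\<^sup>2\<close>; ones fill the rest.\<close>

lemma p_ge_power: "(n div (M + 1)\<^sup>2 + 1) ^ M \<le> p n"
proof -
  define q where "q = n div (M + 1)\<^sup>2"
  define I where "I = {2..M+1}"
  define S where "S = (\<lambda>f. \<Sum>k\<in>I. replicate_mset (f k) k)"
  \<comment> \<open>The subtraction is truncated; \<open>le\<close> below makes it exact on
    \<open>F\<close>.\<close>
  define h where "h = (\<lambda>f. S f + replicate_mset (n - sum_mset (S f)) 1)"
  \<comment> \<open>Extensionality makes a function in \<open>F\<close> determined by its values on
    \<open>I\<close>, as injectivity and the count \<open>(q + 1) ^ M\<close> require.\<close>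
  define F where "F = (I \<rightarrow>\<^sub>E {..q})"
  have count_S: "count (S f) k = (if k \<in> I then f k else 0)" for f k
    by (simp add: S_def count_sum I_def)
  have le: "sum_mset (S f) \<le> n" if "f \<in> F" for f
  proof -
    have "sum_mset (S f) = (\<Sum>k\<in>I. f k * k)"
      unfolding S_def by (induction I rule: infinite_finite_induct) auto
    also have "\<dots> \<le> (\<Sum>k\<in>I. q * (M + 1))"
      using that by (intro sum_mono mult_mono) (auto simp: F_def I_def PiE_iff)
    \<comment> \<open>The \<open>M\<close> summands are rounded up to \<open>M + 1\<close>, which
      produces the square in the definition of \<open>q\<close>.\<close>
    also have "\<dots> \<le> (M + 1) * (q * (M + 1))"
      by (simp add: I_def)
    also have "\<dots> = q * (M + 1)\<^sup>2"
      by (simp add: power2_eq_square algebra_simps)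
    also have "\<dots> \<le> n"
      unfolding q_def by (rule div_times_less_eq_dividend)
    finally show ?thesis .
  qed
  have "inj_on h F"
  proof (rule inj_onI)
    fix f g assume fg: "f \<in> F" "g \<in> F" and eq: "h f = h g"
    have "f k = g k" if "k \<in> I" for k
    proof -
      have "count (h f) k = f k" "count (h g) k = g k"
        \<comment> \<open>Since 1 is not in \<open>I\<close>, the padding by ones leaves these
          multiplicities unchanged.\<close>
        using that by (auto simp: h_def count_S) (auto simp: I_def)
      then show ?thesis using eq by simp
    qed
    then show "f = g"
      using fg unfolding F_def by (metis PiE_ext)
  qed
  moreover have "h ` F \<subseteq> partitions n"
  proof clarify
    fix f assume f: "f \<in> F"
    have "k \<in> I" if "k \<in># S f" for k
      using that count_S[of f k] by (metis not_in_iff)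
    then show "h f \<in> partitions n"
      using le[OF f] by (force simp: h_def partitions_def I_def)
  qed
  ultimately have "card F \<le> p n"
    unfolding p_def by (metis card_image card_mono finite_partitions)
  then show ?thesis
    by (simp add: F_def card_PiE I_def q_def)
qed

text \<open>Taking \<open>M = L + 1\<close> in \<open>p_ge_power\<close> bounds \<open>p n\<close>
  below by a constant times \<open>n ^ (L + 1)\<close>, one degree above the numerator, so the
  quotient is O(1/n).\<close>

lemma power_over_p_tendsto_0: "(\<lambda>n. real ((n + 1) ^ L) / real (p n)) \<longlonglongrightarrow> 0"
proof -
  \<comment> \<open>This is \<open>(M + 1)\<^sup>2\<close> for \<open>M = L + 1\<close>.\<close>
  define c where "c = (real (L + 2))\<^sup>2"
  have c: "c > 0" by (simp add: c_def)
  have "real ((n + 1) ^ L) / real (p n) \<le> 2 ^ L * c ^ (L + 1) / real n" if n: "n > 0" for n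
  proof -
    have "n \<le> (n div (L + 2)\<^sup>2 + 1) * (L + 2)\<^sup>2"
      using dividend_less_div_times[of "(L + 2)\<^sup>2" n] by simp
    then have "real n \<le> real ((n div (L + 2)\<^sup>2 + 1) * (L + 2)\<^sup>2)"
      by (simp only: of_nat_le_iff)
    then have "real n \<le> real (n div (L + 2)\<^sup>2 + 1) * c"
      unfolding c_def by (simp only: of_nat_mult of_nat_power)
    then have "real n / c \<le> real (n div (L + 2)\<^sup>2 + 1)"
      using c by (simp add: pos_divide_le_eq)
    then have "(real n / c) ^ (L + 1) \<le> real (n div (L + 2)\<^sup>2 + 1) ^ (L + 1)"
      using c by (intro power_mono) auto
    also have "\<dots> \<le> real (p n)"
      using p_ge_power[of n "L + 1"] unfolding of_nat_power[symmetric] of_nat_le_iff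
      by (simp only: add.assoc one_add_one)
    finally have "(real n / c) ^ (L + 1) \<le> real (p n)" .
    moreover have "real ((n + 1) ^ L) \<le> (2 * real n) ^ L"
      unfolding of_nat_power using n by (intro power_mono) auto
    ultimately have "real ((n + 1) ^ L) / real (p n) \<le> (2 * real n) ^ L / (real n / c) ^ (L + 1)"
      using n c by (intro frac_le) auto
    also have "\<dots> = 2 ^ L * c ^ (L + 1) / real n"
      using n c by (simp add: power_divide power_mult_distrib)
    finally show ?thesis .
  qed
  then have upper: "\<forall>\<^sub>F n in sequentially. real ((n + 1) ^ L) / real (p n) \<le> 2 ^ L * c ^ (L + 1) / real n"
    by (auto intro: eventually_sequentiallyI[of 1])
  show ?thesis
    by (rule tendsto_sandwich[OF _ upper tendsto_const lim_const_over_n]) simp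
qed

text \<open>The nuclear partitions are split at \<open>K\<close> distinct part sizes; the classes
  may overlap, which an upper bound tolerates. Multiplying by \<open>K\<close> avoids division in
  the natural numbers.\<close>

lemma nu_le: "K * nu n \<le> K * (n + 1) ^ (2 * K) + p n"
proof -
  define A where "A = {P \<in> nuclear_partitions n. K \<le> card (set_mset P)}"
  define B where "B = {P \<in> partitions n. card (set_mset P) \<le> K}"
  have "nuclear_partitions n \<subseteq> B \<union> A"
    by (auto simp: A_def B_def nuclear_partitions_def)
  moreover have "finite (B \<union> A)"
    by (auto simp: A_def B_def finite_partitions finite_nuclear_partitions)
  ultimately have "nu n \<le> card B + card A"
    unfolding nu_def by (meson card_Un_le card_mono le_trans)
  then have "K * nu n \<le> K * card B + K * card A"
    by (metis distrib_left mult_le_mono2)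
  moreover have "K * card B \<le> K * (n + 1) ^ (2 * K)"
    unfolding B_def by (intro mult_le_mono2 card_partitions_few_part_sizes)
  moreover have "K * card A \<le> p n"
    unfolding A_def by (rule card_nuclear_many_part_sizes)
  ultimately show ?thesis by linarith
qed

theorem mainTheorem2:
  shows "(\<lambda>n. real (nu n)) \<in> o(\<lambda>n. real (p n)) \<and>
         (\<lambda>n. real (nu n) / real (p n)) \<longlonglongrightarrow> 0"
proof -
  have "(\<lambda>n. real (nu n) / real (p n)) \<longlonglongrightarrow> 0"
  proof (rule tendstoI)
    fix e :: real assume e: "e > 0"
    \<comment> \<open>\<open>K\<close> is fixed first, to make the share with many part sizes small;
      only then does \<open>n\<close> grow, to make the polynomial term small.\<close>
    obtain K :: nat where K: "K > 0" "1 / real K < e / 2"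
      using e by (metis half_gt_zero inverse_eq_divide reals_Archimedean of_nat_0_less_iff
          zero_less_Suc)
    have "\<forall>\<^sub>F n in sequentially. real ((n + 1) ^ (2 * K)) / real (p n) < e / 2"
      using power_over_p_tendsto_0 e by (intro order_tendstoD(2)) auto
    then show "\<forall>\<^sub>F n in sequentially. dist (real (nu n) / real (p n)) 0 < e"
    proof eventually_elim
      case (elim n)
      have pn: "real (p n) > 0" by (simp add: p_pos)
      have "real K * real (nu n) \<le> real K * real ((n + 1) ^ (2 * K)) + real (p n)"
        using nu_le[of K n] by (metis of_nat_add of_nat_le_iff of_nat_mult)
      then have "real (nu n) / real (p n) \<le> real ((n + 1) ^ (2 * K)) / real (p n) + 1 / real K"
        using pn K(1) by (simp add: field_simps)
      also have "\<dots> < e / 2 + e / 2"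
        using elim K(2) by (rule add_strict_mono)
      finally show ?case by simp
    qed
  qed
  then show ?thesis
    using p_pos by (auto intro!: smalloI_tendsto simp: less_imp_neq)
qed

end
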